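(* For integers $r,p$ with $r\ge 0$ and every integer $n\ge0$, $$\beta_{n,\lambda}^{(p)}(-r)=(-1)^{n}\sum_{k=0}^{n}\frac{\lambda^{k}(1)_{k+1,1/\lambda}}{(k+1)^{p}}\sum_{j=0}^{n}\binom{n}{j}S_{2,\lambda}(j,k)(r)_{n-j,\lambda}=(-1)^{n}\sum_{k=0}^{n}\frac{\lambda^{k}(1)_{k+1,1/\lambda}}{(k+1)^{p}}S_{2,\lambda}^{(r)}(n+r,k+r).$$
   Context: Let $\lambda$ be a nonzero real number. For $\mu\in\mathbb{R}$, $(x)_{0,\mu}=1$, $(x)_{n,\mu}=x(x-\mu)\cdots(x-(n-1)\mu)$ for $n\ge1$, and $e_\mu^x(t)=\sum_{k\ge0}(x)_{k,\mu}t^k/k!$ (formal power series in $t$), $e_\mu(t)=e_\mu^1(t)$; $(x)_k=x(x-1)\cdots(x-k+1)$. The degenerate Stirling numbers of the second kind are defined by $(x)_{n,\lambda}=\sum_{k=0}^n S_{2,\lambda}(n,k)(x)_k$ (with $S_{2,\lambda}(n,k)=0$ for $k>n$), and for an integer $r\ge0$ the degenerate $r$-Stirling numbers of the second kind by $(x+r)_{n,\lambda}=\sum_{k=0}^n S^{(r)}_{2,\lambda}(n+r,k+r)(x)_k$. For $k\in\mathbb{Z}$, the degenerate polylogarithm is $\mathrm{Li}_{k,\lambda}(y)=\sum_{n\ge1}\frac{(-\lambda)^{n-1}(1)_{n,1/\lambda}}{(n-1)!\,n^k}y^n$. The degenerate poly-Bernoulli polynomials of index $k$ are defined by $\frac{\mathrm{Li}_{k,\lambda}(1-e_\lambda(-t))}{1-e_\lambda(-t)}e_\lambda^{-x}(-t)=\sum_{n\ge0}\beta^{(k)}_{n,\lambda}(x)\frac{t^n}{n!}$.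 *)

theory Defs
  imports Complex_Main "HOL-Computational_Algebra.Formal_Power_Series"
begin

definition deg_ffact :: "real \<Rightarrow> real \<Rightarrow> nat \<Rightarrow> real" where
  "deg_ffact \<mu> x n = (\<Prod>i<n. x - real i * \<mu>)"

definition fall_fact :: "real \<Rightarrow> nat \<Rightarrow> real" where
  "fall_fact x k = (\<Prod>i<k. x - real i)"

definition deg_exp :: "real \<Rightarrow> real \<Rightarrow> real fps" where
  "deg_exp \<mu> x = Abs_fps (\<lambda>k. deg_ffact \<mu> x k / fact k)"

text \<open>
  The numbers are given implicitly, as connection coefficients; the lemmas
  \<open>ex1_deg_Stirling2\<close> and \<open>ex1_deg_rStirling2\<close> show that the
  descriptions determine exactly one family each.
\<close>

definition is_deg_Stirling2 :: "real \<Rightarrow> (nat \<Rightarrow> nat \<Rightarrow> real) \<Rightarrow> bool" where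
  "is_deg_Stirling2 l S \<longleftrightarrow>
     (\<forall>n x. deg_ffact l x n = (\<Sum>k=0..n. S n k * fall_fact x k)) \<and>
     (\<forall>n k. k > n \<longrightarrow> S n k = 0)"

definition deg_Stirling2 :: "real \<Rightarrow> nat \<Rightarrow> nat \<Rightarrow> real" where
  "deg_Stirling2 l = (THE S. is_deg_Stirling2 l S)"

text \<open>
  The arguments of the \<open>r\<close>-Stirling numbers are the shifted ones
  \<open>(n + r, k + r)\<close>; values outside \<open>r \<le> K \<le> N\<close> are set to zero.
\<close>

definition is_deg_rStirling2 :: "real \<Rightarrow> nat \<Rightarrow> (nat \<Rightarrow> nat \<Rightarrow> real) \<Rightarrow> bool" where
  "is_deg_rStirling2 l r S \<longleftrightarrow>
     (\<forall>n x. deg_ffact l (x + real r) n = (\<Sum>k=0..n. S (n + r) (k + r) * fall_fact x k)) \<and>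
     (\<forall>N K. \<not> (r \<le> K \<and> K \<le> N) \<longrightarrow> S N K = 0)"

definition deg_rStirling2 :: "real \<Rightarrow> nat \<Rightarrow> nat \<Rightarrow> nat \<Rightarrow> real" where
  "deg_rStirling2 l r = (THE S. is_deg_rStirling2 l r S)"

definition deg_polylog :: "int \<Rightarrow> real \<Rightarrow> real fps" where
  "deg_polylog k l = Abs_fps (\<lambda>n. if n = 0 then 0 else
     (- l) ^ (n - 1) * deg_ffact (1 / l) 1 n / (fact (n - 1) * real n powi k))"

text \<open>
  Division of power series is exact here: see \<open>deg_polylog_quotient\<close>.
\<close>

definition deg_poly_Bernoulli_gf :: "int \<Rightarrow> real \<Rightarrow> real \<Rightarrow> real fps" where
  "deg_poly_Bernoulli_gf k l x =
     (let u = 1 - (deg_exp l 1 oo (- fps_X))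
      in (deg_polylog k l oo u) / u * (deg_exp l (- x) oo (- fps_X)))"

definition deg_poly_Bernoulli :: "int \<Rightarrow> real \<Rightarrow> nat \<Rightarrow> real \<Rightarrow> real" where
  "deg_poly_Bernoulli k l n x = fact n * fps_nth (deg_poly_Bernoulli_gf k l x) n"

lemma fall_fact_Suc: "fall_fact x (Suc k) = (x - real k) * fall_fact x k"
  by (simp add: fall_fact_def mult.commute)

lemma fall_fact_eq_0: "m < k \<Longrightarrow> fall_fact (real m) k = 0"
  by (auto simp: fall_fact_def)

lemma fall_fact_self: "fall_fact (real m) m \<noteq> 0"
  by (auto simp: fall_fact_def)

lemma fall_fact_coeffs_unique:
  assumes "\<And>x. (\<Sum>k=0..n. a k * fall_fact x k) = (\<Sum>k=0..n. b k * fall_fact x k)"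
    and "k \<le> n"
  shows "a k = b k"
  using assms(2)
proof (induction k rule: less_induct)
  case (less m)
  have split: "(\<Sum>k=0..n. c k * fall_fact (real m) k) =
      (\<Sum>k<m. c k * fall_fact (real m) k) + c m * fall_fact (real m) m" for c :: "nat \<Rightarrow> real"
  proof -
    have "(\<Sum>k=0..n. c k * fall_fact (real m) k) = (\<Sum>k\<le>m. c k * fall_fact (real m) k)"
      using less.prems by (intro sum.mono_neutral_right) (auto simp: fall_fact_eq_0)
    also have "{..m} = insert m {..<m}" by auto
    finally show ?thesis by simp
  qed
  have "(\<Sum>k<m. a k * fall_fact (real m) k) = (\<Sum>k<m. b k * fall_fact (real m) k)"
    using less by (intro sum.cong) auto
  with assms(1)[of "real m"] show ?case
    unfolding split by (simp add: fall_fact_self)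
qed

fun rStir :: "real \<Rightarrow> real \<Rightarrow> nat \<Rightarrow> nat \<Rightarrow> real" where
  "rStir l r 0 k = (if k = 0 then 1 else 0)"
| "rStir l r (Suc n) k =
     (if k = 0 then 0 else rStir l r n (k - 1)) + (real k + r - real n * l) * rStir l r n k"

lemma rStir_eq_0: "n < k \<Longrightarrow> rStir l r n k = 0"
  by (induction n arbitrary: k) auto

lemma rStir_expand: "deg_ffact l (x + r) n = (\<Sum>k=0..n. rStir l r n k * fall_fact x k)"
proof (induction n)
  case 0
  show ?case by (simp add: deg_ffact_def fall_fact_def)
next
  case (Suc n)
  have "(\<Sum>k=0..Suc n. rStir l r (Suc n) k * fall_fact x k) =
     (\<Sum>k=0..Suc n. (if k = 0 then 0 else rStir l r n (k - 1)) * fall_fact x k) +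
     (\<Sum>k=0..Suc n. (real k + r - real n * l) * rStir l r n k * fall_fact x k)"
    unfolding sum.distrib[symmetric] by (intro sum.cong) (auto simp: algebra_simps)
  also have "(\<Sum>k=0..Suc n. (if k = 0 then 0 else rStir l r n (k - 1)) * fall_fact x k) =
      (\<Sum>k=0..n. rStir l r n k * fall_fact x (Suc k))"
    by (subst sum.atLeast0_atMost_Suc_shift) simp
  also have "(\<Sum>k=0..Suc n. (real k + r - real n * l) * rStir l r n k * fall_fact x k) =
      (\<Sum>k=0..n. (real k + r - real n * l) * rStir l r n k * fall_fact x k)"
    by (simp add: rStir_eq_0)
  also have "(\<Sum>k=0..n. rStir l r n k * fall_fact x (Suc k)) + \<dots> =
      (x + r - real n * l) * (\<Sum>k=0..n. rStir l r n k * fall_fact x k)"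
    unfolding sum.distrib[symmetric] sum_distrib_left
    by (intro sum.cong) (auto simp: fall_fact_Suc algebra_simps)
  also have "\<dots> = deg_ffact l (x + r) (Suc n)"
    unfolding Suc.IH[symmetric] by (simp add: deg_ffact_def)
  finally show ?case ..
qed

lemma ex1_deg_Stirling2: "\<exists>!S. is_deg_Stirling2 l S"
proof (rule ex_ex1I)
  show "\<exists>S. is_deg_Stirling2 l S"
    using rStir_expand[of l _ 0] rStir_eq_0
    by (intro exI[of _ "rStir l 0"]) (auto simp: is_deg_Stirling2_def)
next
  fix S T
  assume S: "is_deg_Stirling2 l S" and T: "is_deg_Stirling2 l T"
  show "S = T"
  proof (intro ext)
    fix n k
    show "S n k = T n k"
    proof (cases "k \<le> n")
      case True
      then show ?thesis
        using S T fall_fact_coeffs_unique[where n = n and a = "S n" and b = "T n" and k = k]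
        by (simp add: is_deg_Stirling2_def)
    next
      case False
      then show ?thesis using S T by (simp add: is_deg_Stirling2_def)
    qed
  qed
qed

lemma ex1_deg_rStirling2: "\<exists>!S. is_deg_rStirling2 l r S"
proof (rule ex_ex1I)
  have "is_deg_rStirling2 l r
      (\<lambda>N K. if r \<le> K \<and> K \<le> N then rStir l (real r) (N - r) (K - r) else 0)"
    unfolding is_deg_rStirling2_def by (auto simp: rStir_expand intro!: sum.cong)
  then show "\<exists>S. is_deg_rStirling2 l r S" by blast
next
  fix S T
  assume S: "is_deg_rStirling2 l r S" and T: "is_deg_rStirling2 l r T"
  show "S = T"
  proof (intro ext)
    fix N K
    show "S N K = T N K"
    proof (cases "r \<le> K \<and> K \<le> N")
      case True
      define n k where "n = N - r" and "k = K - r"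
      have "k \<le> n" using True by (auto simp: n_def k_def)
      then have "S (n + r) (k + r) = T (n + r) (k + r)"
        using S T
          fall_fact_coeffs_unique[where n = n and k = k
            and a = "\<lambda>k. S (n + r) (k + r)" and b = "\<lambda>k. T (n + r) (k + r)"]
        by (simp add: is_deg_rStirling2_def)
      with True show ?thesis by (simp add: n_def k_def)
    next
      case False
      then show ?thesis using S T by (auto simp: is_deg_rStirling2_def)
    qed
  qed
qed

lemma deg_polylog_quotient:
  fixes l :: real
  defines "u \<equiv> 1 - (deg_exp l 1 oo (- fps_X))"
  shows "(deg_polylog k l oo u) / u * u = deg_polylog k l oo u"
proof -
  have e: "fps_nth (deg_exp l 1 oo (- fps_X)) n = (- 1) ^ n * deg_ffact l 1 n / fact n" for n
    by (simp add: fps_compose_uminus' deg_exp_def)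
  have u0: "fps_nth u 0 = 0" and u1: "fps_nth u 1 = 1"
    unfolding u_def fps_sub_nth e by (simp_all add: deg_ffact_def)
  have nz: "u \<noteq> 0" using u1 by auto
  have sub: "subdegree u = 1"
    using u0 u1 by (intro subdegreeI) auto
  have "fps_nth (deg_polylog k l oo u) 0 = 0"
    by (simp add: deg_polylog_def fps_compose_nth)
  then have "deg_polylog k l oo u = 0 \<or> subdegree (deg_polylog k l oo u) \<ge> 1"
    by (metis less_one not_le nth_subdegree_nonzero)
  then have "u dvd (deg_polylog k l oo u)"
    using nz sub by (cases "deg_polylog k l oo u = 0") (auto simp: fps_dvd_iff)
  then show ?thesis by simp
qed

end

theory Submission
  imports Defs
begin

text \<open>
  Put \<open>e = deg_exp l 1\<close> and \<open>S\<^sub>k(x) = (e - 1)\<^sup>k / k! * deg_exp l x\<close>. A differential equation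
  identifies \<open>deg_exp l x\<close> with the binomial series \<open>(1 + (e - 1))\<^sup>x\<close>; hence
  \<open>deg_exp l (x + r)\<close> is the sum of the series \<open>fall_fact x k * S\<^sub>k(r)\<close>. On coefficients this
  says that the degenerate Stirling numbers are generated by \<open>S\<^sub>k(0)\<close> and the
  \<open>r\<close>-Stirling numbers by \<open>S\<^sub>k(r) = S\<^sub>k(0) * deg_exp l r\<close>. The generating function of the
  poly-Bernoulli polynomials at \<open>- t\<close> is a power series in \<open>1 - e\<close> times \<open>deg_exp l (- x)\<close>,
  that is, a linear combination of the \<open>S\<^sub>k(- x)\<close>.
\<close>

lemma fps_compose_mult_nth:
  fixes a b c :: "'a :: idom fps"
  assumes "fps_nth b 0 = 0"
  shows "fps_nth ((a oo b) * c) n = (\<Sum>k=0..n. fps_nth a k * fps_nth (b ^ k * c) n)"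
proof -
  have "fps_nth (a oo b) i = (\<Sum>k=0..n. fps_nth a k * fps_nth (b ^ k) i)" if "i \<le> n" for i
    unfolding fps_compose_nth using that assms
    by (intro sum.mono_neutral_left) (auto simp: startsby_zero_power_prefix)
  then have "fps_nth ((a oo b) * c) n =
      (\<Sum>i=0..n. \<Sum>k=0..n. fps_nth a k * (fps_nth (b ^ k) i * fps_nth c (n - i)))"
    by (simp add: fps_mult_nth sum_distrib_right mult.assoc)
  also have "\<dots> = (\<Sum>k=0..n. fps_nth a k * fps_nth (b ^ k * c) n)"
    by (subst sum.swap) (simp add: fps_mult_nth sum_distrib_left)
  finally show ?thesis .
qed

lemma fps_compose_self_divide:
  fixes f u :: "'a :: field fps"
  assumes "fps_nth f 0 = 0" and "fps_nth u 0 = 0" and "u \<noteq> 0"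
  shows "(f oo u) / u = fps_shift 1 f oo u"
proof -
  have "f = fps_X * fps_shift 1 f"
    using assms(1) by (intro fps_ext) simp
  then have "f oo u = u * (fps_shift 1 f oo u)"
    using assms(2) by (metis fps_X_fps_compose_startby0 fps_compose_mult_distrib)
  with assms(3) show ?thesis
    by simp
qed

lemma fps_one_plus_const_fps_X_mult_deriv_nth:
  "fps_nth ((1 + fps_const c * fps_X) * fps_deriv f) n =
     of_nat (Suc n) * fps_nth f (Suc n) + of_nat n * c * fps_nth f n"
  for c :: "'a :: comm_ring_1"
  by (cases n) (simp_all add: algebra_simps mult.assoc)

lemma deg_ffact_0 [simp]: "deg_ffact l x 0 = 1"
  by (simp add: deg_ffact_def)

lemma deg_ffact_Suc: "deg_ffact l x (Suc n) = (x - real n * l) * deg_ffact l x n"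
  by (simp add: deg_ffact_def)

lemma deg_exp_nth: "fps_nth (deg_exp l x) n = deg_ffact l x n / fact n"
  by (simp add: deg_exp_def)

lemma deg_exp_nth_0 [simp]: "fps_nth (deg_exp l x) 0 = 1"
  by (simp add: deg_exp_nth)

lemma deg_exp_nth_Suc:
  "real (Suc n) * fps_nth (deg_exp l x) (Suc n) = (x - real n * l) * fps_nth (deg_exp l x) n"
  by (simp add: deg_exp_nth deg_ffact_Suc del: of_nat_Suc)

lemma deg_exp_ODE_unique:
  assumes ODE: "(1 + fps_const l * fps_X) * fps_deriv f = fps_const x * f"
    and init: "fps_nth f 0 = 1"
  shows "f = deg_exp l x"
proof (rule fps_ext)
  fix n
  show "fps_nth f n = fps_nth (deg_exp l x) n"
  proof (induction n)
    case 0
    show ?case by (simp add: init)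
  next
    case (Suc n)
    have "real (Suc n) * fps_nth f (Suc n) = (x - real n * l) * fps_nth f n"
      using fps_one_plus_const_fps_X_mult_deriv_nth[of l f n] unfolding ODE
      by (simp add: algebra_simps)
    also have "\<dots> = real (Suc n) * fps_nth (deg_exp l x) (Suc n)"
      by (simp only: Suc.IH deg_exp_nth_Suc)
    finally show ?case
      by (simp del: of_nat_Suc)
  qed
qed

lemma deg_exp_ODE:
  "(1 + fps_const l * fps_X) * fps_deriv (deg_exp l x) = fps_const x * deg_exp l x"
proof (rule fps_ext)
  fix n
  show "fps_nth ((1 + fps_const l * fps_X) * fps_deriv (deg_exp l x)) n =
      fps_nth (fps_const x * deg_exp l x) n"
    unfolding fps_one_plus_const_fps_X_mult_deriv_nth deg_exp_nth_Suc by (simp add: algebra_simps)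
qed

lemma deg_exp_eq_fps_binomial_compose: "deg_exp l x = fps_binomial x oo (deg_exp l 1 - 1)"
proof -
  define w where "w = deg_exp l 1 - 1"
  have w_0: "fps_nth w 0 = 0"
    by (simp add: w_def)
  have "(1 + fps_const l * fps_X) * fps_deriv w = 1 + w"
    using deg_exp_ODE[of l 1] by (simp add: w_def)
  also have "\<dots> = (1 + fps_X) oo w"
    by (simp add: fps_compose_add_distrib w_0)
  finally have "(1 + fps_const l * fps_X) * fps_deriv (fps_binomial x oo w) =
      ((1 + fps_X) oo w) * (fps_deriv (fps_binomial x) oo w)"
    by (simp add: fps_compose_deriv[OF w_0] mult_ac)
  also have "\<dots> = fps_const x * (fps_binomial x oo w)"
    by (simp add: fps_binomial_deriv w_0
        flip: fps_compose_mult_distrib fps_const_mult_apply_left)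
  finally show ?thesis
    unfolding w_def by (intro deg_exp_ODE_unique[symmetric]) simp_all
qed

lemma deg_exp_add: "deg_exp l (x + y) = deg_exp l x * deg_exp l y"
  unfolding deg_exp_eq_fps_binomial_compose[of l "x + y"]
    deg_exp_eq_fps_binomial_compose[of l x] deg_exp_eq_fps_binomial_compose[of l y]
  by (simp add: fps_binomial_add_mult fps_compose_mult_distrib)

definition deg_Stirling2_poly :: "real \<Rightarrow> nat \<Rightarrow> nat \<Rightarrow> real \<Rightarrow> real" where
  "deg_Stirling2_poly l n k x =
     fact n / fact k * fps_nth ((deg_exp l 1 - 1) ^ k * deg_exp l x) n"

lemma deg_ffact_add_eq_sum_fall_fact:
  "deg_ffact l (x + y) n = (\<Sum>k=0..n. deg_Stirling2_poly l n k y * fall_fact x k)"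
proof -
  have "deg_ffact l (x + y) n =
      fact n * fps_nth ((fps_binomial x oo (deg_exp l 1 - 1)) * deg_exp l y) n"
    by (simp add: deg_exp_nth flip: deg_exp_eq_fps_binomial_compose deg_exp_add)
  also have "\<dots> = (\<Sum>k=0..n. fact n *
      ((x gchoose k) * fps_nth ((deg_exp l 1 - 1) ^ k * deg_exp l y) n))"
    by (simp add: fps_compose_mult_nth sum_distrib_left)
  also have "\<dots> = (\<Sum>k=0..n. deg_Stirling2_poly l n k y * fall_fact x k)"
    by (simp add: deg_Stirling2_poly_def fall_fact_def gbinomial_prod_rev atLeast0LessThan mult_ac)
  finally show ?thesis .
qed

lemma deg_Stirling2_poly_add:
  "deg_Stirling2_poly l n k (x + y) =
     (\<Sum>j=0..n. real (n choose j) * deg_Stirling2_poly l j k x * deg_ffact l y (n - j))"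
proof -
  define F where "F = (deg_exp l 1 - 1) ^ k * deg_exp l x"
  have "deg_Stirling2_poly l n k (x + y) = fact n / fact k * fps_nth (F * deg_exp l y) n"
    by (simp add: deg_Stirling2_poly_def F_def deg_exp_add mult.assoc)
  also have "\<dots> = (\<Sum>j=0..n. fact n / fact k *
      (fps_nth F j * (deg_ffact l y (n - j) / fact (n - j))))"
    by (simp add: fps_mult_nth deg_exp_nth sum_distrib_left)
  also have "\<dots> = (\<Sum>j=0..n. real (n choose j) * (fact j / fact k * fps_nth F j) *
      deg_ffact l y (n - j))"
    by (intro sum.cong) (auto simp: binomial_fact field_simps)
  finally show ?thesis
    by (simp add: deg_Stirling2_poly_def F_def)
qed

lemma deg_Stirling2_poly_eq_0: "n < k \<Longrightarrow> deg_Stirling2_poly l n k x = 0"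
  using startsby_zero_power_prefix[of "deg_exp l 1 - 1" k]
  by (simp add: deg_Stirling2_poly_def fps_mult_nth)

lemma deg_Stirling2_eq_poly: "deg_Stirling2 l = (\<lambda>n k. deg_Stirling2_poly l n k 0)"
  unfolding deg_Stirling2_def
proof (rule the1_equality[OF ex1_deg_Stirling2])
  show "is_deg_Stirling2 l (\<lambda>n k. deg_Stirling2_poly l n k 0)"
    using deg_ffact_add_eq_sum_fall_fact[of l _ 0]
    by (simp add: is_deg_Stirling2_def deg_Stirling2_poly_eq_0)
qed

lemma deg_rStirling2_eq_poly:
  assumes "k \<le> n"
  shows "deg_rStirling2 l r (n + r) (k + r) = deg_Stirling2_poly l n k (real r)"
proof -
  have "is_deg_rStirling2 l r (deg_rStirling2 l r)"
    unfolding deg_rStirling2_def by (rule theI'[OF ex1_deg_rStirling2])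
  then have "(\<Sum>i=0..n. deg_rStirling2 l r (n + r) (i + r) * fall_fact x i) =
      (\<Sum>i=0..n. deg_Stirling2_poly l n i (real r) * fall_fact x i)" for x
    by (simp add: is_deg_rStirling2_def flip: deg_ffact_add_eq_sum_fall_fact)
  from fall_fact_coeffs_unique[OF this assms] show ?thesis .
qed

lemma deg_poly_Bernoulli_gf_eq:
  "deg_poly_Bernoulli_gf p l x =
    ((fps_shift 1 (deg_polylog p l) oo (1 - deg_exp l 1)) * deg_exp l (- x)) oo (- fps_X)"
proof -
  define w where "w = 1 - deg_exp l 1"
  define u where "u = w oo (- fps_X)"
  have w_0: "fps_nth w 0 = 0" and u_0: "fps_nth u 0 = 0"
    by (simp_all add: w_def u_def)
  have "fps_nth u 1 = 1"
    by (simp add: u_def w_def fps_compose_uminus' deg_exp_nth deg_ffact_Suc)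
  then have "u \<noteq> 0"
    by auto
  then have "(deg_polylog p l oo u) / u = fps_shift 1 (deg_polylog p l) oo u"
    by (intro fps_compose_self_divide u_0) (simp_all add: deg_polylog_def)
  also have "\<dots> = (fps_shift 1 (deg_polylog p l) oo w) oo (- fps_X)"
    unfolding u_def by (rule fps_compose_assoc) (simp_all add: w_0)
  finally have "deg_poly_Bernoulli_gf p l x =
      ((fps_shift 1 (deg_polylog p l) oo w) oo (- fps_X)) * (deg_exp l (- x) oo (- fps_X))"
    by (simp add: deg_poly_Bernoulli_gf_def u_def w_def fps_compose_sub_distrib)
  then show ?thesis
    by (simp add: fps_compose_mult_distrib w_def)
qed

lemma deg_poly_Bernoulli_eq_sum:
  "deg_poly_Bernoulli p l n x =
     (-1) ^ n * (\<Sum>k=0..n. l ^ k * deg_ffact (1 / l) 1 (k + 1) / real (k + 1) powi p *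
       deg_Stirling2_poly l n k (- x))"
proof -
  define F where "F = deg_exp l (- x)"
  have one_minus_power_nth: "fps_nth ((1 - deg_exp l 1) ^ k * F) n =
      (-1) ^ k * fps_nth ((deg_exp l 1 - 1) ^ k * F) n" for k
    unfolding minus_diff_eq[of "deg_exp l 1" 1, symmetric]
    by (cases "even k") (simp_all del: minus_diff_eq)
  have summand_eq: "fact n * (fps_nth (deg_polylog p l) (k + 1) *
        fps_nth ((1 - deg_exp l 1) ^ k * F) n) =
      l ^ k * deg_ffact (1 / l) 1 (k + 1) / real (k + 1) powi p *
        deg_Stirling2_poly l n k (- x)" for k
    unfolding one_minus_power_nth
    by (simp add: deg_polylog_def deg_Stirling2_poly_def F_def power_minus[of l] mult_ac)
  have "deg_poly_Bernoulli p l n x = (-1) ^ n * (\<Sum>k=0..n. fact n *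
      (fps_nth (deg_polylog p l) (k + 1) * fps_nth ((1 - deg_exp l 1) ^ k * F) n))"
    by (simp add: deg_poly_Bernoulli_def deg_poly_Bernoulli_gf_eq fps_compose_uminus'
        fps_compose_mult_nth sum_distrib_left mult.left_commute F_def)
  then show ?thesis
    unfolding summand_eq .
qed

theorem theorem10:
  fixes l :: real and p :: int and r n :: nat
  assumes "l \<noteq> 0"
  shows "deg_poly_Bernoulli p l n (- real r) =
           (-1) ^ n * (\<Sum>k=0..n. l ^ k * deg_ffact (1 / l) 1 (k + 1) / real (k + 1) powi p *
             (\<Sum>j=0..n. real (n choose j) * deg_Stirling2 l j k * deg_ffact l (real r) (n - j)))
       \<and> (-1) ^ n * (\<Sum>k=0..n. l ^ k * deg_ffact (1 / l) 1 (k + 1) / real (k + 1) powi p *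
             (\<Sum>j=0..n. real (n choose j) * deg_Stirling2 l j k * deg_ffact l (real r) (n - j)))
         = (-1) ^ n * (\<Sum>k=0..n. l ^ k * deg_ffact (1 / l) 1 (k + 1) / real (k + 1) powi p *
             deg_rStirling2 l r (n + r) (k + r))"
proof -
  have sum_eq_poly: "(\<Sum>j=0..n. real (n choose j) * deg_Stirling2 l j k *
        deg_ffact l (real r) (n - j)) =
      deg_Stirling2_poly l n k (real r)" for k
    using deg_Stirling2_poly_add[of l n k 0 "real r"] by (simp add: deg_Stirling2_eq_poly)
  show ?thesis
    unfolding sum_eq_poly
    by (simp add: deg_poly_Bernoulli_eq_sum deg_rStirling2_eq_poly)
qed

end
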